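(* Let $f=\phi+g$ be a composite convex function, $x_0\in\operatorname{dom} f$ and $K=\{x: f(x)\le f(x_0)\}$. Assume that $\phi\in\mathcal{H}_{2,L,\|\cdot\|}$ for a given norm $\|\cdot\|$, that $f\in\mathcal{L}_{r,\mu,h}(K)$ for $h$ strongly convex with respect to $\|\cdot\|$, and that $g$ is simple, i.e. the problems $\min_z\{y^Tz+g(z)+\lambda D_h(z;x)\}$ can be solved efficiently. Put $\kappa=L/\mu^{2/r}$, $\tau=1-2/r\in[0,1)$ and $c=8e^{2/e}$. Run the restart scheme $x_k=\mathcal{A}(x_{k-1},t_k)$, $k=1,\dots,R$, from $x_0$ with iteration schedule $t_k=C^*_{\kappa,\tau}e^{\tau k}$, for $k=1,\dots,R$, where $$C^*_{\kappa,\tau}=e^{1-\tau}(c\kappa)^{1/2}(f(x_0)-f^* )^{-\tau/2}.$$ The precision reached at the last point $\hat x=x_R$ is given by $$f(\hat x)-f^*\le\exp\left(-2e^{-1}(c\kappa)^{-1/2}N\right)(f(x_0)-f^* )=O\left(\exp(-\kappa^{-1/2}N)\right),\quad\text{when }\tau=0,$$ while $$f(\hat x)-f^*\le\frac{f(x_0)-f^*}{\left(\tau e^{-1}(f(x_0)-f^* )^{\tau/2}(c\kappa)^{-1/2}N+1\right)^{2/\tau}}=O\left(N^{-2/\tau}\right),\quad\text{when }\tau>0,$$ where $N=\sum_{k=1}^R t_k$ is the total number of iterations.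
   Context: $\phi,g$ are convex functions on $\mathbb{R}^n$, $\phi$ being defined on an open set containing $\operatorname{dom} g$, so $\operatorname{dom} f=\operatorname{dom} g$. $X^*$ is the set of minimizers of $f$ and $f^*$ its minimum. $L>0$, $\mu>0$, $r\ge1$ are constants. $\mathcal{H}_{2,L,\|\cdot\|}$ is the set of functions $\phi$ with $\|\nabla\phi(x)-\nabla\phi(y)\|_*\le L\|x-y\|$ for all $x,y\in\operatorname{dom}\phi$ and any subgradients $\nabla\phi(x)\in\partial\phi(x)$, $\nabla\phi(y)\in\partial\phi(y)$, where $\|\cdot\|_*$ is the dual norm of $\|\cdot\|$. The potential function $h$, with $\operatorname{dom} f\subset\operatorname{dom} h$, is differentiable on its domain and strongly convex with parameter one: $h(y)\ge h(x)+\nabla h(x)^T(y-x)+\frac12\|x-y\|^2$ for all $x,y\in\operatorname{dom} h$. Its Bregman divergence is $D_h(y;x)=h(y)-h(x)-\nabla h(x)^T(y-x)$, and $D_h(x,X^* )=\min_{x^*\in X^*}D_h(x^*;x)$. $g$ simple means that for any $x,y\in\operatorname{dom} f$ and $\lambda\ge0$ the problem $\min_z\{y^Tz+g(z)+\lambda D_h(z;x)\}$ can be solved in closed form or by some fast computational procedure. $\mathcal{L}_{r,\mu,h}(K)$ is the set of functions $f$ with $\frac{\mu}{r}D_h(x,X^* )^{r/2}\le f(x)-f^*$ for all $x\in K$ (relative Łojasiewicz growth condition). $\mathcal{A}$ denotes the accelerated gradient method with monotone objective values for this setting: from a starting point $x$ and a number of iterations $t$ it outputs $\mathcal{A}(x,t)$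 with $f(\mathcal{A}(x,t))-f^*\le\frac{8L}{t^2}D_h(x,X^* )$ and $f(\mathcal{A}(x,t))\le f(x)$. Iteration counts $t_k$ are treated as real numbers (rounding to integers is ignored).
   Formalization: For τ=0 the claim O(exp(−κ^{-1/2}N)) is false as written, since 2e^{-1}c^{-1/2}≈0.18<1; what is proved is O(exp(−2e^{-1}c^{-1/2}κ^{-1/2}N)), with the absolute constant kept in the exponent. *)

theory Defs
  imports "HOL-Analysis.Analysis" "HOL-Library.Landau_Symbols"
begin

(* An extended-valued convex function on R^n is a pair of its effective domain D and a
   real-valued function, of which only the values on D matter. *)

definition is_norm :: "(real ^ 'n \<Rightarrow> real) \<Rightarrow> bool" where
  "is_norm nrm \<longleftrightarrow>
     (\<forall>x. nrm x \<ge> 0) \<and> (\<forall>x. nrm x = 0 \<longleftrightarrow> x = 0) \<and>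
     (\<forall>a x. nrm (a *\<^sub>R x) = \<bar>a\<bar> * nrm x) \<and>
     (\<forall>x y. nrm (x + y) \<le> nrm x + nrm y)"

definition dual_norm :: "(real ^ 'n \<Rightarrow> real) \<Rightarrow> real ^ 'n \<Rightarrow> real" where
  "dual_norm nrm y = (SUP x\<in>{x. nrm x \<le> 1}. y \<bullet> x)"

(* Outside D the function is +infinity, so the subgradient inequality is only required on D. *)
definition subdifferential :: "(real ^ 'n) set \<Rightarrow> (real ^ 'n \<Rightarrow> real) \<Rightarrow> real ^ 'n \<Rightarrow> (real ^ 'n) set" where
  "subdifferential D \<phi> x = {p. \<forall>y\<in>D. \<phi> y \<ge> \<phi> x + p \<bullet> (y - x)}"

definition lipschitz_subgradients ::
    "real \<Rightarrow> (real ^ 'n \<Rightarrow> real) \<Rightarrow> (real ^ 'n) set \<Rightarrow> (real ^ 'n \<Rightarrow> real) \<Rightarrow> bool" where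
  "lipschitz_subgradients L nrm D \<phi> \<longleftrightarrow>
     (\<forall>x\<in>D. \<forall>y\<in>D. \<forall>p\<in>subdifferential D \<phi> x. \<forall>q\<in>subdifferential D \<phi> y.
        dual_norm nrm (p - q) \<le> L * nrm (x - y))"

definition minimizers :: "(real ^ 'n) set \<Rightarrow> (real ^ 'n \<Rightarrow> real) \<Rightarrow> (real ^ 'n) set" where
  "minimizers D f = {x. is_arg_min f (\<lambda>x. x \<in> D) x}"

definition min_value :: "(real ^ 'n) set \<Rightarrow> (real ^ 'n \<Rightarrow> real) \<Rightarrow> real" where
  "min_value D f = (INF x\<in>D. f x)"

(* h' is the gradient of h.  The derivative is taken within the domain E: this is the usual
   gradient when E is open, and it also covers potentials whose domain has boundary points. *)
definition potential ::
    "(real ^ 'n \<Rightarrow> real) \<Rightarrow> (real ^ 'n) set \<Rightarrow> (real ^ 'n \<Rightarrow> real) \<Rightarrow> (real ^ 'n \<Rightarrow> real ^ 'n) \<Rightarrow> bool" where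
  "potential nrm E h h' \<longleftrightarrow> convex E \<and>
     (\<forall>x\<in>E. (h has_derivative (\<lambda>v. h' x \<bullet> v)) (at x within E)) \<and>
     (\<forall>x\<in>E. \<forall>y\<in>E. h y \<ge> h x + h' x \<bullet> (y - x) + 1 / 2 * (nrm (x - y))\<^sup>2)"

(* D_h(y; x), in this order of the arguments *)
definition bregman :: "(real ^ 'n \<Rightarrow> real) \<Rightarrow> (real ^ 'n \<Rightarrow> real ^ 'n) \<Rightarrow> real ^ 'n \<Rightarrow> real ^ 'n \<Rightarrow> real" where
  "bregman h h' y x = h y - h x - h' x \<bullet> (y - x)"

(* D_h(x, X); the infimum is the minimum whenever the latter is attained *)
definition bregman_dist ::
    "(real ^ 'n \<Rightarrow> real) \<Rightarrow> (real ^ 'n \<Rightarrow> real ^ 'n) \<Rightarrow> real ^ 'n \<Rightarrow> (real ^ 'n) set \<Rightarrow> real" where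
  "bregman_dist h h' x X = (INF z\<in>X. bregman h h' z x)"

(* f, with effective domain D, belongs to the class L_{r,mu,h}(K) *)
definition rel_lojasiewicz ::
    "real \<Rightarrow> real \<Rightarrow> (real ^ 'n \<Rightarrow> real) \<Rightarrow> (real ^ 'n \<Rightarrow> real ^ 'n) \<Rightarrow> (real ^ 'n) set \<Rightarrow> (real ^ 'n) set \<Rightarrow>
     (real ^ 'n \<Rightarrow> real) \<Rightarrow> bool" where
  "rel_lojasiewicz r \<mu> h h' K D f \<longleftrightarrow>
     (\<forall>x\<in>K. \<mu> / r * bregman_dist h h' x (minimizers D f) powr (r / 2) \<le> f x - min_value D f)"

(* Solvability of the proximal subproblems; computational cost is not modelled.  A minimizer is
   demanded for l > 0 only, since for l = 0 the problem is in general unbounded below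
   (e.g. if g = 0). *)
definition simple ::
    "(real ^ 'n \<Rightarrow> real) \<Rightarrow> (real ^ 'n \<Rightarrow> real ^ 'n) \<Rightarrow> (real ^ 'n) set \<Rightarrow> (real ^ 'n \<Rightarrow> real) \<Rightarrow> bool" where
  "simple h h' D g \<longleftrightarrow>
     (\<forall>x\<in>D. \<forall>y\<in>D. \<forall>l>0. \<exists>z. is_arg_min (\<lambda>z. y \<bullet> z + g z + l * bregman h h' z x) (\<lambda>z. z \<in> D) z)"

(* The guarantees of the accelerated gradient method with monotone objective values; A x t is its
   output after t iterations from x, t being treated as a real number.  The rate is not claimed
   for t = 0, where the bound 8 L / t^2 is infinite. *)
definition monotone_accelerated ::
    "real \<Rightarrow> (real ^ 'n \<Rightarrow> real) \<Rightarrow> (real ^ 'n \<Rightarrow> real ^ 'n) \<Rightarrow> (real ^ 'n) set \<Rightarrow> (real ^ 'n \<Rightarrow> real) \<Rightarrow>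
     (real ^ 'n \<Rightarrow> real \<Rightarrow> real ^ 'n) \<Rightarrow> bool" where
  "monotone_accelerated L h h' D f A \<longleftrightarrow>
     (\<forall>x\<in>D. \<forall>t\<ge>0. A x t \<in> D \<and> f (A x t) \<le> f x) \<and>
     (\<forall>x\<in>D. \<forall>t>0. f (A x t) - min_value D f \<le> 8 * L / t\<^sup>2 * bregman_dist h h' x (minimizers D f))"

primrec restart :: "('a \<Rightarrow> real \<Rightarrow> 'a) \<Rightarrow> (nat \<Rightarrow> real) \<Rightarrow> 'a \<Rightarrow> nat \<Rightarrow> 'a" where
  "restart A t x0 0 = x0"
| "restart A t x0 (Suc k) = A (restart A t x0 k) (t (Suc k))"

end

theory Submission
  imports Defs
begin

text \<open>
  The growth condition bounds the Bregman distance to the minimizers by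
  \<open>(r (f x - f*) / \<mu>) powr (2 / r)\<close>, and \<open>r powr (2 / r) \<le> exp (2 / e)\<close>; so one run of \<open>t\<close> iterations
  turns a gap \<open>\<delta>\<close> into at most \<open>c \<kappa> \<delta> powr (1 - \<tau>) / t\<^sup>2\<close>. The schedule is chosen so that this
  recursion contracts the gap by \<open>exp (-2)\<close> in each restart. The bounds in terms of the total
  number of iterations follow by summing the geometric series, using \<open>\<tau> \<le> exp \<tau> - 1\<close>.
\<close>

text \<open>Source of the factor \<open>exp (2 / exp 1)\<close> in \<open>c\<close>: the quotient
  \<open>ln r / r\<close> is largest at \<open>r = exp 1\<close>, as the tangent to
  \<open>ln\<close> at that point shows.\<close>

lemma powr_two_div_self_le:
  fixes r :: real
  assumes "r > 0"
  shows "r powr (2 / r) \<le> exp (2 / exp 1)"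
proof -
  have "ln (r / exp 1) \<le> r / exp 1 - 1"
    using assms by (intro ln_le_minus_one) simp
  then have "ln r \<le> r / exp 1"
    using assms by (simp add: ln_div)
  then have "2 / r * ln r \<le> 2 / r * (r / exp 1)"
    using assms by (intro mult_left_mono) auto
  then show ?thesis
    using assms by (simp add: powr_def)
qed

text \<open>Solves the growth inequality for \<open>d\<close> by raising both sides to the power
  \<open>2 / r\<close>. This needs \<open>d \<ge> 0\<close>, and the sign of \<delta> is then forced
  by the inequality itself.\<close>

lemma le_powr_of_growth:
  fixes d \<mu> r \<delta> :: real
  assumes "d \<ge> 0" "\<mu> > 0" "r > 0" "\<mu> / r * d powr (r / 2) \<le> \<delta>"
  shows "d \<le> r powr (2 / r) * \<delta> powr (2 / r) / \<mu> powr (2 / r)"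
proof -
  have "0 \<le> \<mu> / r * d powr (r / 2)"
    using assms by simp
  then have \<delta>: "\<delta> \<ge> 0"
    using assms(4) by linarith
  have "d powr (r / 2) \<le> r * \<delta> / \<mu>"
    using assms by (simp add: field_simps)
  then have "(d powr (r / 2)) powr (2 / r) \<le> (r * \<delta> / \<mu>) powr (2 / r)"
    using assms by (intro powr_mono2) auto
  then show ?thesis
    using assms \<delta> by (simp add: powr_powr powr_mult powr_divide)
qed

lemma minimizersD:
  assumes "z \<in> minimizers D f"
  shows "z \<in> D" "min_value D f = f z" "\<And>x. x \<in> D \<Longrightarrow> f z \<le> f x"
proof -
  show *: "z \<in> D" and **: "\<And>x. x \<in> D \<Longrightarrow> f z \<le> f x"
    using assms by (auto simp: minimizers_def is_arg_min_linorder)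
  show "min_value D f = f z"
    unfolding min_value_def using * ** by (intro cInf_eq_minimum) auto
qed

text \<open>Strong convexity bounds each divergence below by half a squared norm. This supplies the
  sign needed to invert the growth condition.\<close>

lemma bregman_dist_nonneg:
  assumes "potential nrm E h h'" "x \<in> E" "X \<subseteq> E" "X \<noteq> {}"
  shows "bregman_dist h h' x X \<ge> 0"
  unfolding bregman_dist_def
proof (rule cINF_greatest[OF assms(4)])
  fix z assume "z \<in> X"
  then have "h z \<ge> h x + h' x \<bullet> (z - x) + 1 / 2 * (nrm (x - z))\<^sup>2"
    using assms unfolding potential_def by blast
  moreover have "(nrm (x - z))\<^sup>2 \<ge> 0" by simp
  ultimately show "0 \<le> bregman h h' z x"
    unfolding bregman_def by linarith
qed

text \<open>The recursion for one run: the accelerated rate contributes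
  \<open>8 * L / s\<^sup>2\<close>, and the inverted growth condition replaces the distance by a
  power of the current gap.\<close>

lemma gap_decrease:
  fixes L \<mu> r s :: real
  assumes "L > 0" "\<mu> > 0" "r > 0"
    and pot: "potential nrm E h h'" "D \<subseteq> E"
    and ne: "minimizers D f \<noteq> {}"
    and loja: "rel_lojasiewicz r \<mu> h h' K D f"
    and acc: "monotone_accelerated L h h' D f A"
    and x: "x \<in> D" "x \<in> K" and s: "s > 0"
  shows "f (A x s) - min_value D f
    \<le> 8 * exp (2 / exp 1) * (L / \<mu> powr (2 / r)) * (f x - min_value D f) powr (2 / r) / s\<^sup>2"
proof -
  let ?d = "bregman_dist h h' x (minimizers D f)" and ?\<delta> = "f x - min_value D f"
  have sub: "minimizers D f \<subseteq> E"
    using pot(2) minimizersD(1) by blast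
  have "x \<in> E" using x pot(2) by blast
  then have "?d \<ge> 0"
    using bregman_dist_nonneg[OF pot(1) _ sub ne] by blast
  moreover have "\<mu> / r * ?d powr (r / 2) \<le> ?\<delta>"
    using loja x unfolding rel_lojasiewicz_def by blast
  ultimately have "?d \<le> r powr (2 / r) * ?\<delta> powr (2 / r) / \<mu> powr (2 / r)"
    using assms by (intro le_powr_of_growth) auto
  also have "\<dots> \<le> exp (2 / exp 1) * ?\<delta> powr (2 / r) / \<mu> powr (2 / r)"
    using powr_two_div_self_le[OF \<open>r > 0\<close>]
    by (intro divide_right_mono mult_right_mono) auto
  finally have "8 * L / s\<^sup>2 * ?d \<le> 8 * L / s\<^sup>2 * (exp (2 / exp 1) * ?\<delta> powr (2 / r) / \<mu> powr (2 / r))"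
    using assms by (intro mult_left_mono) auto
  moreover have "f (A x s) - min_value D f \<le> 8 * L / s\<^sup>2 * ?d"
    using acc x s unfolding monotone_accelerated_def by blast
  ultimately show ?thesis
    by (simp add: algebra_simps)
qed

text \<open>The schedule \<open>s\<close> is found by asking that
  \<open>\<delta> k = exp (- 2 * real k) * \<delta> 0\<close> solve the recursion with equality.
  Solving for \<open>s (Suc k)\<close> and writing the result in terms of \<open>Suc k\<close>
  leaves the factor \<open>exp (1 - \<tau>)\<close>.\<close>

lemma geometric_decay:
  fixes q \<tau> :: real and \<delta> s :: "nat \<Rightarrow> real"
  assumes "q > 0" "0 \<le> \<tau>" "\<tau> < 1" "\<delta> 0 > 0"
    and nonneg: "\<And>k. \<delta> k \<ge> 0"
    and s: "\<And>k. s k = exp (1 - \<tau>) * q powr (1 / 2) * \<delta> 0 powr (- \<tau> / 2) * exp (\<tau> * real k)"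
    and step: "\<And>k. \<delta> (Suc k) \<le> q * \<delta> k powr (1 - \<tau>) / (s (Suc k))\<^sup>2"
  shows "\<delta> k \<le> exp (- 2 * real k) * \<delta> 0"
proof (induction k)
  case 0
  show ?case by simp
next
  case (Suc k)
  \<comment> \<open>With every factor written as an exponential, the induction step becomes an
    identity linear in \<open>ln q\<close> and \<open>ln (\<delta> 0)\<close>.\<close>
  have s_exp: "s (Suc k) = exp (1 - \<tau> + ln q / 2 - \<tau> / 2 * ln (\<delta> 0) + \<tau> * real (Suc k))"
    using assms(1,4) by (simp add: s powr_def exp_add[symmetric] exp_minus[symmetric])
  have "\<delta> k powr (1 - \<tau>) \<le> (exp (- 2 * real k) * \<delta> 0) powr (1 - \<tau>)"
    using Suc nonneg assms by (intro powr_mono2) auto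
  also have "\<dots> = exp ((1 - \<tau>) * (ln (\<delta> 0) - 2 * real k))"
    using assms by (simp add: powr_def ln_mult)
  finally have "q * \<delta> k powr (1 - \<tau>) / (s (Suc k))\<^sup>2
      \<le> q * exp ((1 - \<tau>) * (ln (\<delta> 0) - 2 * real k)) / (s (Suc k))\<^sup>2"
    using assms(1) by (intro divide_right_mono mult_left_mono) auto
  also have "\<dots> = exp (ln q + (1 - \<tau>) * (ln (\<delta> 0) - 2 * real k)
      - 2 * (1 - \<tau> + ln q / 2 - \<tau> / 2 * ln (\<delta> 0) + \<tau> * real (Suc k)))"
    using assms(1) unfolding s_exp exp_double[symmetric] exp_diff exp_add[of "ln q"] by simp
  \<comment> \<open>The terms in \<open>ln q\<close> cancel, and \<open>ln (\<delta> 0)\<close> gets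
    the coefficient \<open>(1 - \<tau>) + \<tau> = 1\<close>.\<close>
  also have "\<dots> = exp (ln (\<delta> 0) - 2 * real (Suc k))"
    by (rule arg_cong[of _ _ exp]) (simp add: field_simps)
  also have "\<dots> = exp (- 2 * real (Suc k)) * \<delta> 0"
    using assms(4) unfolding diff_conv_add_uminus exp_add by simp
  finally show ?case
    using step[of k] by linarith
qed

text \<open>Converts the number of restarts into the total number of iterations. The exact geometric
  sum has \<open>exp \<tau> - 1\<close> where the bound has the smaller \<tau>; the induction adds
  one term at a time and uses this comparison.\<close>

lemma sum_exp_bound:
  fixes \<tau> :: real
  assumes "\<tau> > 0"
  shows "\<tau> * exp (- \<tau>) * (\<Sum>k=1..R. exp (\<tau> * real k)) + 1 \<le> exp (\<tau> * real R)"
proof (induction R)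
  case 0
  show ?case by simp
next
  case (Suc R)
  have "\<tau> * exp (\<tau> * real R) \<le> (exp \<tau> - 1) * exp (\<tau> * real R)"
    using exp_ge_add_one_self[of \<tau>] by (intro mult_right_mono) (linarith, simp)
  moreover have "\<tau> * exp (- \<tau>) * exp (\<tau> * real (Suc R)) = \<tau> * exp (\<tau> * real R)"
    by (simp add: exp_add[symmetric] algebra_simps)
  moreover have "(exp \<tau> - 1) * exp (\<tau> * real R) = exp (\<tau> * real (Suc R)) - exp (\<tau> * real R)"
    by (simp add: exp_add algebra_simps)
  moreover have "\<tau> * exp (- \<tau>) * (\<Sum>k=1..Suc R. exp (\<tau> * real k))
      = \<tau> * exp (- \<tau>) * (\<Sum>k=1..R. exp (\<tau> * real k)) + \<tau> * exp (- \<tau>) * exp (\<tau> * real (Suc R))"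
    by (simp add: distrib_left)
  ultimately show ?case
    using Suc by linarith
qed

text \<open>Dropping the \<open>+ 1\<close> exposes the pure power of \<open>M\<close> for the
  asymptotic claims.\<close>

lemma powr_affine_bound:
  fixes a b M p :: real
  assumes "a > 0" "M > 0" "b \<ge> 0" "p \<ge> 0"
  shows "b / (a * M + 1) powr p \<le> b * a powr (- p) * M powr (- p)"
proof -
  have "(a * M) powr p \<le> (a * M + 1) powr p"
    using assms by (intro powr_mono2) auto
  moreover have "(a * M) powr p > 0"
    using assms by simp
  ultimately have "b / (a * M + 1) powr p \<le> b / (a * M) powr p"
    using assms by (intro frac_le) auto
  also have "\<dots> = b * a powr (- p) * M powr (- p)"
    using assms by (simp add: powr_mult powr_minus field_simps)
  finally show ?thesis .
qed

theorem corollary5p3: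
  fixes nrm :: "real ^ 'n \<Rightarrow> real"
    and D\<phi> Dg Dh K :: "(real ^ 'n) set"
    and \<phi> g f h :: "real ^ 'n \<Rightarrow> real"
    and h' :: "real ^ 'n \<Rightarrow> real ^ 'n"
    and A :: "real ^ 'n \<Rightarrow> real \<Rightarrow> real ^ 'n"
    and x0 :: "real ^ 'n"
    and x :: "nat \<Rightarrow> real ^ 'n"
    and L \<mu> r \<kappa> \<tau> c C fstar :: real
    and t N :: "nat \<Rightarrow> real"
  assumes "L > 0" "\<mu> > 0" "r \<ge> 1"
    and "is_norm nrm"
    and "convex_on D\<phi> \<phi>" "convex_on Dg g" "Dg \<subseteq> interior D\<phi>"
    and "f = (\<lambda>z. \<phi> z + g z)"
    and "minimizers Dg f \<noteq> {}" "fstar = min_value Dg f"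
    and "Dg \<subseteq> Dh" "potential nrm Dh h h'"
    and "x0 \<in> Dg" "K = {z \<in> Dg. f z \<le> f x0}"
    and "lipschitz_subgradients L nrm D\<phi> \<phi>"
    and "rel_lojasiewicz r \<mu> h h' K Dg f"
    and "simple h h' Dg g"
    and "monotone_accelerated L h h' Dg f A"
    and "\<kappa> = L / \<mu> powr (2 / r)" "\<tau> = 1 - 2 / r" "0 \<le> \<tau>" "\<tau> < 1"
    and "c = 8 * exp (2 / exp 1)"
    and "C = exp (1 - \<tau>) * (c * \<kappa>) powr (1 / 2) * (f x0 - fstar) powr (- \<tau> / 2)"
    and "\<And>k. t k = C * exp (\<tau> * real k)"
    and "x = restart A t x0"
    and "\<And>R. N R = (\<Sum>k=1..R. t k)"
  shows "(\<tau> = 0 \<longrightarrow>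
      (\<forall>R. f (x R) - fstar \<le> exp (- 2 * exp (-1) * (c * \<kappa>) powr (- 1 / 2) * N R) * (f x0 - fstar)) \<and>
      (\<lambda>M::real. exp (- 2 * exp (-1) * (c * \<kappa>) powr (- 1 / 2) * M) * (f x0 - fstar))
        \<in> O(\<lambda>M. exp (- (2 * exp (-1) * c powr (- 1 / 2)) * (\<kappa> powr (- 1 / 2) * M))) \<and>
      (\<lambda>R. f (x R) - fstar)
        \<in> O(\<lambda>R. exp (- (2 * exp (-1) * c powr (- 1 / 2)) * (\<kappa> powr (- 1 / 2) * N R)))) \<and>
    (\<tau> > 0 \<longrightarrow>
      (\<forall>R. f (x R) - fstar \<le> (f x0 - fstar) /
         (\<tau> * exp (-1) * (f x0 - fstar) powr (\<tau> / 2) * (c * \<kappa>) powr (- 1 / 2) * N R + 1) powr (2 / \<tau>)) \<and>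
      (\<lambda>M::real. (f x0 - fstar) /
         (\<tau> * exp (-1) * (f x0 - fstar) powr (\<tau> / 2) * (c * \<kappa>) powr (- 1 / 2) * M + 1) powr (2 / \<tau>))
        \<in> O(\<lambda>M. M powr (- 2 / \<tau>)) \<and>
      (\<lambda>R. f (x R) - fstar) \<in> O(\<lambda>R. N R powr (- 2 / \<tau>)))"
proof -
  let ?\<delta> = "\<lambda>k. f (x k) - fstar"
  obtain z where z: "z \<in> minimizers Dg f" using assms by blast
  have fstar_le: "fstar \<le> f y" if "y \<in> Dg" for y
    using minimizersD(2,3)[OF z] that assms(10) by simp
  have x_0: "x 0 = x0" and x_Suc: "x (Suc k) = A (x k) (t (Suc k))" for k
    using assms(26) by auto
  have \<kappa>: "\<kappa> > 0" and c: "c > 0" and r: "2 / r = 1 - \<tau>" "r > 0"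
    using assms(1-3,19,20,23) by auto
  \<comment> \<open>\<open>a\<close> cancels the factor \<open>(c * \<kappa>) powr (1 / 2)\<close>
    of \<open>C\<close>.\<close>
  define a where "a = (c * \<kappa>) powr (- 1 / 2)"
  have a: "a > 0" "a * (c * \<kappa>) powr (1 / 2) = 1"
    using \<kappa> c by (simp_all add: a_def powr_add[symmetric])
  have C: "C \<ge> 0" "t k \<ge> 0" for k
    by (simp_all add: assms(24,25))
  \<comment> \<open>Monotonicity keeps all iterates in the sublevel set \<open>K\<close>, where the
    growth condition holds.\<close>
  have xD: "x k \<in> Dg \<and> f (x k) \<le> f x0" for k
  proof (induction k)
    case 0
    show ?case using assms(13) x_0 by simp
  next
    case (Suc k)
    then have "A (x k) (t (Suc k)) \<in> Dg \<and> f (A (x k) (t (Suc k))) \<le> f (x k)"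
      using assms(18) C unfolding monotone_accelerated_def by blast
    then show ?case
      using Suc unfolding x_Suc by linarith
  qed
  have \<delta>_nonneg: "?\<delta> k \<ge> 0" for k
    using xD fstar_le by simp
  have gap0: "f x0 - fstar \<ge> 0"
    using fstar_le[OF assms(13)] by simp
  have N_eq: "N R = C * (\<Sum>k=1..R. exp (\<tau> * real k))" for R
    by (simp add: assms(25,27) sum_distrib_left)
  have N_nonneg: "N R \<ge> 0" for R
    unfolding N_eq using C(1) by (intro mult_nonneg_nonneg sum_nonneg) auto
  \<comment> \<open>If the initial gap is zero, then \<open>0 powr _ = 0\<close> gives
    \<open>C = 0\<close> and all \<open>t k = 0\<close>, so no rate is available; monotonicity alone
    keeps the gap at zero.\<close>
  have decay: "?\<delta> k \<le> exp (- 2 * real k) * (f x0 - fstar)" for k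
  proof (cases "f x0 = fstar")
    case True
    then show ?thesis using xD[of k] by simp
  next
    case False
    then have pos: "f x0 - fstar > 0" using gap0 by simp
    have t_pos: "t k > 0" for k
      using pos c \<kappa> by (simp add: assms(24,25))
    have "?\<delta> (Suc k) \<le> (c * \<kappa>) * ?\<delta> k powr (1 - \<tau>) / (t (Suc k))\<^sup>2" for k
      using gap_decrease[OF assms(1,2) r(2) assms(12,11,9,16,18) _ _ t_pos, of "x k" "Suc k"] xD[of k]
      by (simp add: x_Suc assms(14) assms(10)[symmetric] assms(19,23) r(1))
    from geometric_decay[of "c * \<kappa>" \<tau> ?\<delta> t, OF _ assms(21,22) _ _ _ this] show ?thesis
      using pos c \<kappa> \<delta>_nonneg by (simp add: x_0 assms(24,25))
  qed
  show ?thesis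
  proof (intro conjI impI)
    assume \<tau>: "\<tau> = 0"
    have bound: "?\<delta> R \<le> exp (- 2 * exp (-1) * (c * \<kappa>) powr (- 1 / 2) * N R) * (f x0 - fstar)" for R
    proof (cases "f x0 = fstar")
      case True
      then show ?thesis using decay[of R] by simp
    next
      case False
      \<comment> \<open>The schedule is constant here, so \<open>N R = C * real R\<close> and the
        exponent is exactly \<open>- 2 * real R\<close>. A nonzero gap is needed for its power with
        exponent 0 to be 1.\<close>
      then have "C = exp 1 * (c * \<kappa>) powr (1 / 2)"
        using \<tau> gap0 by (simp add: assms(24))
      then have "- 2 * exp (-1) * a * N R = - 2 * (exp (-1) * exp 1) * (a * (c * \<kappa>) powr (1 / 2)) * real R"
        by (simp add: N_eq \<tau>)
      also have "\<dots> = - 2 * real R"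
        unfolding a(2) by (simp add: exp_add[symmetric])
      finally show ?thesis
        using decay[of R] unfolding a_def by (simp only:)
    qed
    then show "\<forall>R. ?\<delta> R \<le> exp (- 2 * exp (-1) * (c * \<kappa>) powr (- 1 / 2) * N R) * (f x0 - fstar)"
      by blast
    \<comment> \<open>A constant factor inside an exponent cannot be absorbed into \<open>O\<close>,
      so it is kept explicit.\<close>
    have exponent: "- 2 * exp (-1) * (c * \<kappa>) powr (- 1 / 2) * M
        = - (2 * exp (-1) * c powr (- 1 / 2)) * (\<kappa> powr (- 1 / 2) * M)" for M
      using c \<kappa> by (simp add: powr_mult)
    show "(\<lambda>M::real. exp (- 2 * exp (-1) * (c * \<kappa>) powr (- 1 / 2) * M) * (f x0 - fstar))
        \<in> O(\<lambda>M. exp (- (2 * exp (-1) * c powr (- 1 / 2)) * (\<kappa> powr (- 1 / 2) * M)))"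
      unfolding exponent by (intro bigoI[where c = "f x0 - fstar"]) (use gap0 in \<open>simp add: abs_mult\<close>)
    show "?\<delta> \<in> O(\<lambda>R. exp (- (2 * exp (-1) * c powr (- 1 / 2)) * (\<kappa> powr (- 1 / 2) * N R)))"
    proof (intro bigoI[where c = "f x0 - fstar"] always_eventually allI)
      fix R
      show "norm (?\<delta> R) \<le> (f x0 - fstar)
          * norm (exp (- (2 * exp (-1) * c powr (- 1 / 2)) * (\<kappa> powr (- 1 / 2) * N R)))"
        using bound[of R] \<delta>_nonneg[of R] unfolding exponent by (simp add: mult.commute)
    qed
  next
    assume \<tau>: "\<tau> > 0"
    define b where "b = \<tau> * exp (-1) * (f x0 - fstar) powr (\<tau> / 2) * (c * \<kappa>) powr (- 1 / 2)"
    \<comment> \<open>Taking the bound as a function of a real \<open>M\<close> serves both the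
      limit in \<open>M\<close> and the values \<open>M = N R\<close>.\<close>
    define G where "G M = (f x0 - fstar) / (b * M + 1) powr (2 / \<tau>)" for M
    have b: "b \<ge> 0" using \<tau> by (simp add: b_def)
    have bound: "?\<delta> R \<le> G (N R)" for R
    proof (cases "f x0 = fstar")
      case True
      then show ?thesis using decay[of R] by (simp add: G_def)
    next
      case False
      \<comment> \<open>The powers of the gap and of \<open>c * \<kappa>\<close> in \<open>b\<close>
        and \<open>C\<close> cancel, leaving the coefficient of
        \<open>sum_exp_bound\<close>.\<close>
      then have "(f x0 - fstar) powr (\<tau> / 2) * (f x0 - fstar) powr (- \<tau> / 2) = 1"
        by (simp add: powr_add[symmetric])
      moreover have "exp (-1) * exp (1 - \<tau>) = exp (- \<tau>)"
        by (simp add: exp_add[symmetric])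
      moreover have "b * C = \<tau> * (exp (-1) * exp (1 - \<tau>)) * (a * (c * \<kappa>) powr (1 / 2))
          * ((f x0 - fstar) powr (\<tau> / 2) * (f x0 - fstar) powr (- \<tau> / 2))"
        by (simp add: b_def a_def assms(24))
      ultimately have "b * C = \<tau> * exp (- \<tau>)"
        using a(2) by simp
      then have "b * N R + 1 \<le> exp (\<tau> * real R)"
        using sum_exp_bound[OF \<tau>, of R] by (simp add: N_eq mult.assoc[symmetric])
      then have "(b * N R + 1) powr (2 / \<tau>) \<le> exp (\<tau> * real R) powr (2 / \<tau>)"
        using \<tau> b N_nonneg by (intro powr_mono2) auto
      also have "\<dots> = exp (2 * real R)"
        using \<tau> by (simp add: powr_def)
      finally have le: "(b * N R + 1) powr (2 / \<tau>) \<le> exp (2 * real R)" .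
      have "b * N R + 1 > 0"
        using b N_nonneg[of R] by (simp add: add_nonneg_pos)
      then have "(f x0 - fstar) / exp (2 * real R) \<le> G (N R)"
        unfolding G_def using le gap0 by (intro divide_left_mono) auto
      moreover have "(f x0 - fstar) / exp (2 * real R) = exp (- 2 * real R) * (f x0 - fstar)"
        by (simp add: exp_minus divide_inverse mult.commute)
      ultimately show ?thesis
        using decay[of R] by linarith
    qed
    then show "\<forall>R. ?\<delta> R \<le> (f x0 - fstar) /
         (\<tau> * exp (-1) * (f x0 - fstar) powr (\<tau> / 2) * (c * \<kappa>) powr (- 1 / 2) * N R + 1) powr (2 / \<tau>)"
      unfolding G_def b_def by blast
    \<comment> \<open>A zero gap also makes \<open>b\<close> zero, but then \<open>G\<close>
      vanishes identically.\<close>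
    have G_le: "G M \<le> (f x0 - fstar) * b powr (- 2 / \<tau>) * M powr (- 2 / \<tau>)" if "M > 0" for M
    proof (cases "f x0 = fstar")
      case True
      then show ?thesis by (simp add: G_def)
    next
      case False
      then have "b > 0"
        using gap0 \<tau> c \<kappa> by (simp add: b_def)
      then show ?thesis
        using powr_affine_bound[of b M "f x0 - fstar" "2 / \<tau>"] that gap0 \<tau> by (simp add: G_def)
    qed
    have G_nonneg: "G M \<ge> 0" for M
      using gap0 by (simp add: G_def)
    have "G \<in> O(\<lambda>M. M powr (- 2 / \<tau>))"
      by (rule bigoI, rule eventually_mono[OF eventually_gt_at_top[of 0]])
        (use G_le G_nonneg in auto)
    then show "(\<lambda>M::real. (f x0 - fstar) /
         (\<tau> * exp (-1) * (f x0 - fstar) powr (\<tau> / 2) * (c * \<kappa>) powr (- 1 / 2) * M + 1) powr (2 / \<tau>))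
        \<in> O(\<lambda>M. M powr (- 2 / \<tau>))"
      unfolding G_def b_def .
    show "?\<delta> \<in> O(\<lambda>R. N R powr (- 2 / \<tau>))"
    \<comment> \<open>With zero gap \<open>N R = 0\<close>, so the comparison function is zero too
      and the gaps must vanish exactly. Otherwise \<open>N R > 0\<close> once \<open>R > 0\<close>,
      and \<open>G_le\<close> applies pointwise; \<open>N 0\<close> is an empty sum.\<close>
    proof (cases "f x0 = fstar")
      case True
      then have "?\<delta> k = 0" for k
        using decay[of k] \<delta>_nonneg[of k] by simp
      then show ?thesis by simp
    next
      case False
      then have "C > 0"
        using gap0 c \<kappa> by (simp add: assms(24))
      then have N_pos: "N R > 0" if "R > 0" for R
        unfolding N_eq using that by (intro mult_pos_pos sum_pos) auto
      have "?\<delta> R \<le> (f x0 - fstar) * b powr (- 2 / \<tau>) * N R powr (- 2 / \<tau>)" if "R > 0" for R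
        using bound[of R] G_le[OF N_pos[OF that]] by linarith
      then show ?thesis
        by (intro bigoI, intro eventually_mono[OF eventually_gt_at_top[of 0]])
          (use \<delta>_nonneg in auto)
    qed
  qed
qed

end
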